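(* Let $k\ge 2$, $\Sigma=\{\sigma_1,\dots,\sigma_k\}$, let $B_k(z)=\sum_{\beta} z^{|\beta|}$ be the generating function of all regular expressions over $\Sigma$, and $R_k(z)=\sum_{\alpha\in\mathrm{RE}_{na}} z^{|\alpha|}$ that of $\mathrm{RE}_{na}$ (both defined below). Then $$\frac{[z^n]R_k(z)}{[z^n]B_k(z)} \sim \frac{\sqrt{\psi_k(\eta_k)}}{\sqrt{2-2\rho_k}}\left(\frac{\rho_k}{\eta_k}\right)^{n+1}\qquad (n\to\infty),$$ where $\rho_k=\frac{1}{1+\sqrt{8+8k}}$.
   Context: Regular expressions over $\Sigma$ are generated by $\beta := \varepsilon \mid \sigma\ (\sigma\in\Sigma) \mid (\beta+\beta) \mid (\beta\cdot\beta) \mid (\beta^\star)$ (the empty-set expression is not counted). The size $|\beta|$ is the number of occurrences of the symbols $\varepsilon$, letters, $+$, $\cdot$, $\star$ in $\beta$ (parentheses not counted). A $\Sigma$-star expression is an expression $(\tau^\star)$ where $\tau$ is a fully parenthesized union of the $k$ letters, each occurring exactly once, in any order and any bracketing; there are $C_k:=\frac{(2k-2)!}{(k-1)!}$ of them, each of size $2k$. $\mathrm{RE}_{na}$ is the set of regular expressions having no subexpression $(\beta_1+\beta_2)$ in which $\beta_1$ or $\beta_2$ is a $\Sigma$-star expression. Define $p_k(z)=1-2z-(7+8k)z^2$, $h_k(z)=1-z-C_k z^{2k+1}$, $\Delta_k(z)=p_k(z)+4z^{2k+1}C_k h_k(z)$. Let $\eta_k$ be the unique real root of $\Delta_k$ in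 $\left(0,\frac{1}{\sqrt{8+8k}}\right)$, and $\psi_k(\eta_k):=-\eta_k\Delta_k'(\eta_k)$. $[z^n]F(z)$ denotes the coefficient of $z^n$, and $a_n\sim b_n$ means $a_n/b_n\to1$. *)

theory Defs
  imports "HOL-Analysis.Analysis" "HOL-Library.Landau_Symbols" "HOL-Library.Multiset"
begin

text \<open>Regular expressions over the alphabet {0,...,k-1} (letter i stands for sigma_(i+1)).
  The empty-set expression is not included.\<close>
datatype rexp = Eps | Lett nat | Plus rexp rexp | Times rexp rexp | Star rexp

fun rsize :: "rexp \<Rightarrow> nat" where
  "rsize Eps = 1"
| "rsize (Lett a) = 1"
| "rsize (Plus r s) = rsize r + rsize s + 1"
| "rsize (Times r s) = rsize r + rsize s + 1"
| "rsize (Star r) = rsize r + 1"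

fun over :: "nat \<Rightarrow> rexp \<Rightarrow> bool" where
  "over k Eps = True"
| "over k (Lett a) = (a < k)"
| "over k (Plus r s) = (over k r \<and> over k s)"
| "over k (Times r s) = (over k r \<and> over k s)"
| "over k (Star r) = over k r"

fun union_tree :: "rexp \<Rightarrow> bool" where
  "union_tree (Lett a) = True"
| "union_tree (Plus r s) = (union_tree r \<and> union_tree s)"
| "union_tree _ = False"

fun leaves :: "rexp \<Rightarrow> nat list" where
  "leaves (Lett a) = [a]"
| "leaves (Plus r s) = leaves r @ leaves s"
| "leaves _ = []"

fun sigma_star :: "nat \<Rightarrow> rexp \<Rightarrow> bool" where
  "sigma_star k (Star t) = (union_tree t \<and> mset (leaves t) = mset [0..<k])"
| "sigma_star k _ = False"

fun na :: "nat \<Rightarrow> rexp \<Rightarrow> bool" where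
  "na k Eps = True"
| "na k (Lett a) = True"
| "na k (Plus r s) = (\<not> sigma_star k r \<and> \<not> sigma_star k s \<and> na k r \<and> na k s)"
| "na k (Times r s) = (na k r \<and> na k s)"
| "na k (Star r) = na k r"

definition B_coeff :: "nat \<Rightarrow> nat \<Rightarrow> nat" where
  "B_coeff k n = card {r. over k r \<and> rsize r = n}"

definition R_coeff :: "nat \<Rightarrow> nat \<Rightarrow> nat" where
  "R_coeff k n = card {r. over k r \<and> na k r \<and> rsize r = n}"

definition Ck :: "nat \<Rightarrow> real" where
  "Ck k = fact (2*k - 2) / fact (k - 1)"

definition pk :: "nat \<Rightarrow> real \<Rightarrow> real" where
  "pk k z = 1 - 2*z - (7 + 8 * real k) * z^2"

definition hk :: "nat \<Rightarrow> real \<Rightarrow> real" where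
  "hk k z = 1 - z - Ck k * z^(2*k+1)"

definition Deltak :: "nat \<Rightarrow> real \<Rightarrow> real" where
  "Deltak k z = pk k z + 4 * z^(2*k+1) * Ck k * hk k z"

definition etak :: "nat \<Rightarrow> real" where
  "etak k = (THE eta. 0 < eta \<and> eta < 1 / sqrt (8 + 8 * real k) \<and> Deltak k eta = 0)"

definition psik :: "nat \<Rightarrow> real \<Rightarrow> real" where
  "psik k x = - x * deriv (Deltak k) x"

definition rhok :: "nat \<Rightarrow> real" where
  "rhok k = 1 / (1 + sqrt (8 + 8 * real k))"

end

theory Submission
  imports Defs "HOL-Complex_Analysis.Complex_Analysis" "HOL-Real_Asymp.Real_Asymp"
    "HOL-Combinatorics.Multiset_Permutations"
begin

text \<open>The grammars give quadratic equations for the generating functions, so that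
  \<open>4zB = 1 - z - sqrt p\<close> and \<open>4zR = 1 - z + 2C z^(2k+1) - sqrt \<Delta>\<close>. Both radicands have the shape
  \<open>(1 - z / a) g(z)\<close> with \<open>Re g > 0\<close> on the disc of radius \<open>1 / sqrt (8 + 8k) > a\<close>,
  where \<open>a\<close> is \<open>\<rho>\<close> or \<open>\<eta>\<close>. Hence the \<open>n\<close>-th coefficient of each root is asymptotically
  \<open>sqrt (g(a))\<close> times that of \<open>sqrt (1 - z / a)\<close>; in the quotient the binomial coefficients
  cancel. For \<open>\<Delta>\<close>, the positivity of \<open>Re g\<close> comes from the perturbation \<open>\<Delta> - p\<close> having
  Lipschitz constant below \<open>1\<close> on the disc, and \<open>g(\<eta>) = -\<eta> \<Delta>'(\<eta>)\<close>.\<close>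

unbundle no vec_syntax

section \<open>Coefficient asymptotics at a square-root singularity\<close>

lemma gbinomial_half_Suc:
  "(1/2 gchoose Suc n) = (1/2 - of_nat n) / of_nat (Suc n) * ((1/2 :: 'a :: field_char_0) gchoose n)"
proof -
  have "of_nat (Suc n) * ((1/2 :: 'a) gchoose Suc n) = (1/2 - of_nat n) * (1/2 gchoose n)"
    by (simp only: gbinomial_absorption gbinomial_absorb_comp)
  then show ?thesis
    by (simp add: field_simps del: of_nat_Suc)
qed

lemma gbinomial_half_nonzero: "((1/2 :: real) gchoose n) \<noteq> 0"
proof (induction n)
  case (Suc n)
  have "(1/2 :: real) \<noteq> of_nat n"
  proof
    assume "(1/2 :: real) = of_nat n"
    then have "real (2 * n) = real 1" by simp
    then have "2 * n = 1" by (simp only: of_nat_eq_iff)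
    then show False by presburger
  qed
  then show ?case
    using Suc by (simp add: gbinomial_half_Suc del: of_nat_Suc)
qed simp

text \<open>Each unit step contributes the factor \<open>(n + 1) / (1/2 - n)\<close>, which tends to
  -1; the power of -1 compensates the \<open>j\<close> signs.\<close>

lemma gbinomial_half_ratio_limit:
  "(\<lambda>n. (-1) ^ j * (((1/2 :: real) gchoose n) / (1/2 gchoose (n + j)))) \<longlonglongrightarrow> 1"
proof (induction j)
  case 0
  then show ?case by (simp add: gbinomial_half_nonzero)
next
  case (Suc j)
  have "(\<lambda>n. (real (n + j) + 1) / (real (n + j) - 1/2)) \<longlonglongrightarrow> 1"
    by real_asymp
  from tendsto_mult[OF Suc this]
  have "(\<lambda>n. (-1) ^ j * (((1/2 :: real) gchoose n) / (1/2 gchoose (n + j)))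
      * ((real (n + j) + 1) / (real (n + j) - 1/2))) \<longlonglongrightarrow> 1"
    by simp
  then show ?case
  proof (rule Lim_transform_eventually)
    have "\<forall>\<^sub>F n in sequentially. n \<ge> 1" by (rule eventually_ge_at_top)
    then show "\<forall>\<^sub>F n in sequentially.
       (-1) ^ j * ((1/2 gchoose n) / (1/2 gchoose (n + j))) * ((real (n + j) + 1) / (real (n + j) - 1/2))
       = (-1) ^ Suc j * (((1/2::real) gchoose n) / (1/2 gchoose (n + Suc j)))"
    proof eventually_elim
      case (elim n)
      define y where "y = 1/2 - real (n + j)"
      have y: "y \<noteq> 0" "real (n + j) - 1/2 = - y" using elim by (auto simp: y_def)
      have "(1/2::real) gchoose (n + Suc j) = y / (real (n + j) + 1) * (1/2 gchoose (n+j))"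
        using gbinomial_half_Suc[of "n+j", where 'a=real] by (simp add: y_def add_ac)
      then show ?case
        unfolding y(2) using y(1) by (simp add: mult_ac)
    qed
  qed
qed

text \<open>The coefficients decay only polynomially, so a polynomial weight makes them
  nondecreasing in absolute value. The exponent 4 is the least integer for which this works at
  \<open>m = 1\<close>.\<close>

lemma gbinomial_half_step_bound:
  "\<bar>(1/2::real) gchoose m\<bar> * (real m + 1) ^ 4 \<le> \<bar>1/2 gchoose Suc m\<bar> * (real m + 2) ^ 4"
proof -
  have "(real m + 1) ^ 5 \<le> \<bar>1/2 - real m\<bar> * (real m + 2) ^ 4"
  proof (cases "m = 0")
    case False
    then obtain l where l: "m = Suc l" by (cases m) auto
    have "0 \<le> real l" by simp
    \<comment> \<open>Expanded in powers of \<open>l\<close>, the difference has only nonnegative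
      coefficients.\<close>
    then have "0 \<le> (real l + 1/2) * (real l + 3) ^ 4 - (real l + 2) ^ 5"
      by (simp add: field_simps eval_nat_numeral)
    then show ?thesis
      by (simp add: l add_ac)
  qed simp
  then have "\<bar>(1/2::real) gchoose m\<bar> * ((real m + 1) ^ 5 / (real m + 1)) \<le>
     \<bar>(1/2::real) gchoose m\<bar> * ((\<bar>1/2 - real m\<bar> * (real m + 2) ^ 4) / (real m + 1))"
    by (intro mult_left_mono divide_right_mono) auto
  also have "(real m + 1) ^ 5 / (real m + 1) = (real m + 1) ^ 4"
    by (simp add: divide_simps eval_nat_numeral)
  finally show ?thesis
    by (simp add: gbinomial_half_Suc abs_mult add_ac mult_ac)
qed

text \<open>Telescoping the step bound and using \<open>m + j + 1 \<le> (j + 1) * (m + 1)\<close>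
  removes \<open>m\<close> from the factor. This uniformity supplies the dominating series in
  Tannery's theorem.\<close>

lemma gbinomial_half_bound:
  "\<bar>(1/2::real) gchoose m\<bar> \<le> (real j + 1) ^ 4 * \<bar>1/2 gchoose (m + j)\<bar>"
proof -
  have "\<bar>(1/2::real) gchoose m\<bar> * (real m + 1) ^ 4 \<le> \<bar>1/2 gchoose (m+j)\<bar> * (real (m + j) + 1) ^ 4"
  proof (induction j)
    case (Suc j)
    with gbinomial_half_step_bound[of "m + j"] show ?case
      by (simp add: add_ac)
  qed simp
  also have "\<dots> \<le> \<bar>1/2 gchoose (m+j)\<bar> * ((real j + 1) * (real m + 1)) ^ 4"
    by (intro mult_left_mono power_mono) (auto simp: algebra_simps)
  finally have "\<bar>(1/2::real) gchoose m\<bar> * (real m + 1) ^ 4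
      \<le> ((real j + 1) ^ 4 * \<bar>1/2 gchoose (m+j)\<bar>) * (real m + 1) ^ 4"
    by (simp add: power_mult_distrib mult_ac)
  then show ?thesis
    by (rule mult_right_le_imp_le) simp
qed

section \<open>Formal square roots and transfer to coefficients\<close>

text \<open>Over an integral domain a square determines its root up to sign, and the constant term 1
  fixes the sign in characteristic 0.\<close>

lemma fps_sqrt_unique:
  fixes F G :: "'a :: {idom, ring_char_0} fps"
  assumes "F\<^sup>2 = G\<^sup>2" "F $ 0 = 1" "G $ 0 = 1"
  shows "F = G"
proof -
  have "F = G \<or> F = - G"
    using assms(1) by (simp add: power2_eq_iff)
  moreover have "F \<noteq> - G"
  proof
    assume "F = - G"
    then have "F $ 0 = - (G $ 0)" by simp
    with assms(2,3) have "(1::'a) + 1 = 0" by (metis eq_neg_iff_add_eq_0)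
    then show False by simp
  qed
  ultimately show ?thesis by blast
qed

text \<open>The formal sqrt(1 + cX). It serves with \<open>c = -1/a\<close> for the singular factor
  and with \<open>c = -4\<close> for the Catalan numbers.\<close>

lemma fps_binomial_half_scaled_power2:
  "(fps_binomial (1/2) oo (fps_const c * fps_X))\<^sup>2 = 1 + fps_const (c :: 'a :: field_char_0) * fps_X"
proof -
  have "(fps_binomial (1/2) oo (fps_const c * fps_X))\<^sup>2 = (fps_binomial (1/2) ^ 2) oo (fps_const c * fps_X)"
    by (rule fps_compose_power) (simp only: fps_mult_nth_0, simp)
  also have "fps_binomial (1/2::'a) ^ 2 = 1 + fps_X"
    by (simp add: fps_binomial_power fps_binomial_1)
  also have "(1 + fps_X) oo (fps_const c * fps_X) = 1 + fps_const c * fps_X"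
    by (simp add: fps_compose_add_distrib fps_compose_1 fps_X_fps_compose_startby0)
  finally show ?thesis .
qed

text \<open>The factor \<open>sqrt (1 - z / a)\<close> carries the singularity, and convolution with the
  coefficients of the factor \<open>sqrt g\<close>, which is holomorphic in a larger disc,
  only changes the constant (Tannery).\<close>

lemma sqrt_singularity_transfer:
  fixes F :: "complex fps" and g :: "complex \<Rightarrow> complex" and a r :: real
  assumes a: "0 < a" "a < r"
    and hol: "g holomorphic_on ball 0 r"
    and pos: "\<And>z. norm z < r \<Longrightarrow> Re (g z) > 0"
    and expansion: "(\<lambda>z. (1 - z / of_real a) * g z) has_fps_expansion F\<^sup>2"
    and F0: "F $ 0 = 1"
  shows "(\<lambda>n. F $ n / of_real ((1/2 gchoose n) * (- 1 / a) ^ n)) \<longlonglongrightarrow> csqrt (g (of_real a))"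
proof -
  define A where "A = fps_binomial (1/2 :: complex) oo (fps_const (of_real (- 1 / a)) * fps_X)"
  define f where "f = (\<lambda>z. csqrt (g z))"
  define H where "H = fps_expansion f 0"
  define w where "w = (\<lambda>n. (1/2 gchoose n) * (- 1 / a) ^ n)"
  define G where "G = fps_expansion g 0"
  have G: "g has_fps_expansion G"
    unfolding G_def by (rule has_fps_expansion_fps_expansion[of "ball 0 r"]) (use hol a in auto)
  have "(\<lambda>z. (1 - of_real (1/a) * z) * g z) has_fps_expansion (1 - fps_const (of_real (1/a)) * fps_X) * G"
    by (intro fps_expansion_intros G)
  then have F2: "F\<^sup>2 = (1 - fps_const (of_real (1/a)) * fps_X) * G"
    using fps_expansion_unique_complex[OF expansion] by (simp add: field_simps)
  \<comment> \<open>Since \<open>Re (g z) > 0\<close>, the values of \<open>g\<close> avoid the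
    branch cut of \<open>csqrt\<close>.\<close>
  have holf: "f holomorphic_on eball 0 (ereal r)"
    unfolding f_def eball_ereal
    by (rule holomorphic_on_csqrt') (use hol pos in \<open>force simp: complex_nonpos_Reals_iff\<close>)+
  have r: "r > 0" using a by simp
  have H: "f has_fps_expansion H"
    unfolding H_def by (rule has_fps_expansion_fps_expansion[of "ball 0 r"]) (use holf r in auto)
  have "(\<lambda>z. f z * f z) has_fps_expansion H * H"
    by (intro has_fps_expansion_mult H)
  then have "g has_fps_expansion H * H"
    by (simp add: f_def power2_eq_square[symmetric])
  with G have HG: "H * H = G"
    by (meson fps_expansion_unique_complex)
  have A2: "A\<^sup>2 = 1 - fps_const (of_real (1/a)) * fps_X"
    unfolding A_def fps_binomial_half_scaled_power2 by (simp del: fps_const_neg add: fps_const_neg[symmetric])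
  have An: "A $ n = of_real (w n)" for n
  proof -
    have "complex_of_real ((1/2) gchoose n) = (1/2) gchoose n"
      by (simp add: gbinomial_prod_rev)
    then show ?thesis
      unfolding A_def fps_nth_compose_linear by (simp add: w_def mult_ac)
  qed
  have wn: "w n \<noteq> 0" for n using a by (simp add: w_def gbinomial_half_nonzero)
  have G0: "G $ 0 = 1"
    using arg_cong[OF F2, of "\<lambda>h. h $ 0"] F0 by (simp add: power2_eq_square fps_mult_nth_0)
  have "(H $ 0) = f 0"
    using has_fps_expansion_imp_0_eq_fps_nth_0[OF H] by simp
  moreover have "g 0 = 1"
    using has_fps_expansion_imp_0_eq_fps_nth_0[OF G] G0 by simp
  ultimately have H0: "H $ 0 = 1" by (simp add: f_def)
  have A0: "A $ 0 = 1" by (simp add: A_def)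
  \<comment> \<open>A purely formal identity: the squares agree and all constant terms are 1, so
    \<open>F\<close> is the product of the singular root \<open>A\<close> and the regular root
    \<open>H\<close>.\<close>
  have FAH: "F = A * H"
  proof (rule fps_sqrt_unique)
    show "F\<^sup>2 = (A * H)\<^sup>2"
      by (simp only: F2 power_mult_distrib A2 HG[symmetric] power2_eq_square[of H])
  qed (use F0 A0 H0 in auto)
  \<comment> \<open>Any radius strictly between \<open>a\<close> and \<open>r\<close> would do:
    \<open>H $ j\<close> is then bounded by a multiple of \<open>1 / r' ^ j\<close>, and
    \<open>a / r' < 1\<close>.\<close>
  define r' where "r' = (a + r) / 2"
  have r': "0 < r'" "r' < r" "a < r'" using a by (auto simp: r'_def)
  have conv: "fps_conv_radius H \<ge> ereal r"
    unfolding H_def by (rule conv_radius_fps_expansion) (use holf in auto)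
  have sums_f: "(\<lambda>n. H $ n * z ^ n) sums f z" if "norm z < r" for z
    using holomorphic_power_series[of f 0 r z] holf that by (simp add: H_def fps_expansion_def)
  have "summable (\<lambda>n. H $ n * of_real r' ^ n)"
    using sums_f[of "of_real r'"] r' by (auto simp: sums_iff)
  then have "Bseq (\<lambda>n. H $ n * of_real r' ^ n)"
    by (intro convergent_imp_Bseq) (metis summable_LIMSEQ_zero convergent_def)
  then obtain K where K: "K > 0" "\<And>n. norm (H $ n * of_real r' ^ n) \<le> K"
    by (meson BseqE)
  define M where "M = (\<lambda>j. K * ((a / r') ^ j * (real j + 1) ^ 4))"
  have q: "0 < a / r'" "a / r' < 1" using a r' by (auto simp: field_simps)
  have "summable M"
    unfolding M_def
  proof (intro summable_mult)
    define x where "x = a / r'"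
    define y where "y = (x + 1) / 2"
    have xy: "0 < x" "x < y" "y < 1" using q by (auto simp: x_def[symmetric] y_def)
    have "(\<lambda>j. x ^ j * (real j + 1) ^ 4) \<in> O(\<lambda>j. y ^ j)"
      using xy by real_asymp
    moreover have "summable (\<lambda>j. norm (y ^ j))"
      using xy by (simp add: norm_power summable_geometric)
    ultimately show "summable (\<lambda>j. (a / r') ^ j * (real j + 1) ^ 4)"
      unfolding x_def by (rule summable_comparison_test_bigo[rotated])
  qed
  \<comment> \<open>The \<open>j\<close>-th term of the convolution for \<open>F $ n / w n\<close>,
    extended by 0 beyond \<open>n\<close> so that the finite sums become series over a fixed index
    set.\<close>
  define s where "s = (\<lambda>j n. if j \<le> n then H $ j * of_real (w (n - j) / w n) else 0)"
  have lim: "(\<lambda>n. s j n) \<longlonglongrightarrow> H $ j * of_real a ^ j" for j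
  proof -
    have "(\<lambda>n. w n / w (n + j)) = (\<lambda>n. a ^ j * ((-1) ^ j * ((1/2 gchoose n) / (1/2 gchoose (n + j)))))"
    proof
      fix n
      have "a ^ j * ((-1) ^ j * (- (1 / a)) ^ j) = 1"
        using a by (simp flip: power_mult_distrib)
      then show "w n / w (n + j) = a ^ j * ((-1) ^ j * ((1/2 gchoose n) / (1/2 gchoose (n + j))))"
        using a gbinomial_half_nonzero[of n] gbinomial_half_nonzero[of "n+j"]
        by (simp add: w_def power_add power_divide divide_simps)
    qed
    then have "(\<lambda>n. w n / w (n + j)) \<longlonglongrightarrow> a ^ j * 1"
      by (simp only:) (intro tendsto_mult tendsto_const gbinomial_half_ratio_limit)
    then have "(\<lambda>n. H $ j * of_real (w n / w (n + j))) \<longlonglongrightarrow> H $ j * of_real (a ^ j * 1)"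
      by (intro tendsto_intros)
    then have "(\<lambda>n. s j (n + j)) \<longlonglongrightarrow> H $ j * of_real a ^ j"
      by (simp add: s_def)
    then show ?thesis by (rule LIMSEQ_offset)
  qed
  have bound: "norm (s j n) \<le> M j" for j n
  proof (cases "j \<le> n")
    case True
    then obtain m where n: "n = m + j" by (metis le_add_diff_inverse2)
    have "\<bar>w m / w (m + j)\<bar> = a ^ j * (\<bar>1/2 gchoose m\<bar> / \<bar>1/2 gchoose (m + j)\<bar>)"
      using a gbinomial_half_nonzero[of m] gbinomial_half_nonzero[of "m+j"]
      by (simp add: w_def abs_mult power_add power_divide divide_simps power_abs)
    also have "\<dots> \<le> a ^ j * (real j + 1) ^ 4"
      using gbinomial_half_bound[of m j] a gbinomial_half_nonzero[of "m+j"]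
      by (intro mult_left_mono) (auto simp: field_simps)
    finally have *: "\<bar>w m / w (m + j)\<bar> \<le> a ^ j * (real j + 1) ^ 4" .
    have "norm (H $ j) \<le> K / r' ^ j"
      using K(2)[of j] r' by (simp add: norm_mult norm_power field_simps)
    then have "norm (H $ j) * \<bar>w m / w (m + j)\<bar> \<le> K / r' ^ j * (a ^ j * (real j + 1) ^ 4)"
      using * K(1) r' by (intro mult_mono) auto
    then show ?thesis
      using True by (simp add: s_def M_def n norm_mult power_divide norm_divide)
  qed (use K(1) q in \<open>simp add: s_def M_def\<close>)
  have "(\<lambda>n. \<Sum>j. s j n) \<longlonglongrightarrow> (\<Sum>j. H $ j * of_real a ^ j)"
    using tannerys_theorem[OF lim always_eventually \<open>summable M\<close>] bound by simp
  moreover have "(\<Sum>j. H $ j * of_real a ^ j) = f (of_real a)"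
    using sums_f[of "of_real a"] a by (auto simp: sums_iff)
  moreover have "(\<Sum>j. s j n) = F $ n / of_real (w n)" for n
  proof -
    have "(\<Sum>j. s j n) = (\<Sum>j\<le>n. s j n)"
      by (rule suminf_finite) (auto simp: s_def)
    also have "\<dots> = (\<Sum>j\<le>n. H $ j * of_real (w (n - j))) / of_real (w n)"
      by (simp add: s_def sum_divide_distrib)
    also have "(\<Sum>j\<le>n. H $ j * of_real (w (n - j))) = F $ n"
      by (simp add: FAH mult.commute[of A] fps_mult_nth An atLeast0AtMost)
    finally show ?thesis .
  qed
  ultimately show ?thesis by (simp add: f_def w_def)
qed

section \<open>Generating functions\<close>

text \<open>The coefficients are complex so that these series can be compared with expansions of
  holomorphic functions. \<open>card\<close> would give 0 on infinite size classes; over a finite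
  alphabet all of them are finite.\<close>

definition gf :: "rexp set \<Rightarrow> complex fps" where
  "gf A = Abs_fps (\<lambda>n. of_nat (card {r \<in> A. rsize r = n}))"

lemma rsize_pos: "rsize r > 0"
  by (cases r) auto

lemma finite_over_rsize_le: "finite {r. over k r \<and> rsize r \<le> n}"
proof (induction n)
  case 0
  have "{r. over k r \<and> rsize r \<le> 0} = {}" using rsize_pos by (auto simp: neq0_conv)
  then show ?case by (simp only: finite.emptyI)
next
  case (Suc n)
  let ?S = "{r. over k r \<and> rsize r \<le> n}"
  have "r \<in> insert Eps (Lett ` {..<k}) \<union> Star ` ?S \<union> case_prod Plus ` (?S \<times> ?S) \<union> case_prod Times ` (?S \<times> ?S)"
    if "over k r" "rsize r \<le> Suc n" for r
    using that by (cases r) auto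
  then have "{r. over k r \<and> rsize r \<le> Suc n} \<subseteq>
      insert Eps (Lett ` {..<k}) \<union> Star ` ?S \<union> case_prod Plus ` (?S \<times> ?S) \<union> case_prod Times ` (?S \<times> ?S)"
    by blast
  then show ?case
    by (rule finite_subset) (use Suc in auto)
qed

lemma finite_rsize_eq:
  assumes "A \<subseteq> Collect (over k)"
  shows "finite {r \<in> A. rsize r = n}"
  by (rule finite_subset[OF _ finite_over_rsize_le[of k n]]) (use assms in auto)

lemma gf_Un:
  assumes "A \<subseteq> Collect (over k)" "B \<subseteq> Collect (over k)" "A \<inter> B = {}"
  shows "gf (A \<union> B) = gf A + gf B"
proof (rule fps_ext)
  fix n
  have "{r \<in> A \<union> B. rsize r = n} = {r \<in> A. rsize r = n} \<union> {r \<in> B. rsize r = n}" by auto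
  moreover have "card ({r \<in> A. rsize r = n} \<union> {r \<in> B. rsize r = n})
      = card {r \<in> A. rsize r = n} + card {r \<in> B. rsize r = n}"
    using assms finite_rsize_eq[of A k n] finite_rsize_eq[of B k n] by (intro card_Un_disjoint) auto
  ultimately show "gf (A \<union> B) $ n = (gf A + gf B) $ n"
    by (simp add: gf_def)
qed

lemma gf_unary:
  assumes "inj c" "\<And>r. rsize (c r) = Suc (rsize r)"
  shows "gf (c ` A) = fps_X * gf A"
proof (rule fps_ext)
  fix n
  show "gf (c ` A) $ n = (fps_X * gf A) $ n"
  proof (cases n)
    case 0
    then have "{r \<in> c ` A. rsize r = n} = {}" using assms by auto
    then have "card {r \<in> c ` A. rsize r = n} = 0" by (simp only: card.empty)
    with 0 show ?thesis by (simp add: gf_def)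
  next
    case (Suc m)
    then have "{r \<in> c ` A. rsize r = n} = c ` {r \<in> A. rsize r = m}" using assms(2) by auto
    moreover have "card (c ` {r \<in> A. rsize r = m}) = card {r \<in> A. rsize r = m}"
      by (intro card_image inj_on_subset[OF assms(1)]) auto
    ultimately show ?thesis using Suc by (simp add: gf_def)
  qed
qed

lemma gf_binary:
  assumes sub: "A \<subseteq> Collect (over k)" "B \<subseteq> Collect (over k)"
    and inj: "inj (case_prod c)"
    and size: "\<And>r s. rsize (c r s) = Suc (rsize r + rsize s)"
  shows "gf (case_prod c ` (A \<times> B)) = fps_X * (gf A * gf B)"
proof (rule fps_ext)
  fix n
  show "gf (case_prod c ` (A \<times> B)) $ n = (fps_X * (gf A * gf B)) $ n"
  proof (cases n)
    case 0
    then have "{r \<in> case_prod c ` (A \<times> B). rsize r = n} = {}" using size by auto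
    then have "card {r \<in> case_prod c ` (A \<times> B). rsize r = n} = 0" by (simp only: card.empty)
    with 0 show ?thesis by (simp add: gf_def)
  next
    case (Suc m)
    define P where "P = (\<lambda>i. {r \<in> A. rsize r = i} \<times> {r \<in> B. rsize r = m - i})"
    have "{r \<in> case_prod c ` (A \<times> B). rsize r = n} = case_prod c ` (\<Union>i\<in>{0..m}. P i)"
    proof (intro equalityI subsetI)
      fix t assume "t \<in> {r \<in> case_prod c ` (A \<times> B). rsize r = n}"
      then obtain r s where rs: "t = c r s" "r \<in> A" "s \<in> B" "rsize r + rsize s = m"
        using Suc by (auto simp: size)
      then have "(r, s) \<in> P (rsize r)" "rsize r \<in> {0..m}" by (auto simp: P_def)
      then show "t \<in> case_prod c ` (\<Union>i\<in>{0..m}. P i)"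
        unfolding rs(1) by (intro image_eqI[of _ _ "(r, s)"]) auto
    qed (use Suc in \<open>auto simp: size P_def\<close>)
    then have "card {r \<in> case_prod c ` (A \<times> B). rsize r = n} = card (case_prod c ` (\<Union>i\<in>{0..m}. P i))"
      by (rule arg_cong)
    also have "\<dots> = card (\<Union>i\<in>{0..m}. P i)"
      by (intro card_image inj_on_subset[OF inj]) auto
    also have "card (\<Union>i\<in>{0..m}. P i) = (\<Sum>i=0..m. card (P i))"
      using finite_rsize_eq[OF sub(1)] finite_rsize_eq[OF sub(2)]
      by (intro card_UN_disjoint) (auto simp: P_def)
    finally have "gf (case_prod c ` (A \<times> B)) $ n = (gf A * gf B) $ m"
      using \<open>n = Suc m\<close> by (simp add: gf_def P_def card_cartesian_product fps_mult_nth)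
    then show ?thesis
      using Suc by (simp only: fps_X_mult_nth) simp
  qed
qed

lemma gf_atoms: "gf (insert Eps (Lett ` {..<k})) = fps_const (of_nat (k + 1)) * fps_X"
proof (rule fps_ext)
  fix n
  have "{r \<in> insert Eps (Lett ` {..<k}). rsize r = n} = (if n = 1 then insert Eps (Lett ` {..<k}) else {})"
    by auto
  moreover have "card (insert Eps (Lett ` {..<k})) = k + 1"
    by (subst card_insert_disjoint) (auto simp: card_image inj_on_def)
  ultimately show "gf (insert Eps (Lett ` {..<k})) $ n = (fps_const (of_nat (k + 1)) * fps_X) $ n"
    by (simp add: gf_def)
qed

text \<open>\<open>P\<close> is the set of admissible operands of a union. It is \<open>A\<close>
  itself for all expressions, and \<open>A\<close> without the Sigma-star expressions for the
  restricted class, so one grammar covers both.\<close>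

lemma gf_grammar:
  assumes "A \<subseteq> Collect (over k)" "P \<subseteq> Collect (over k)"
    and A: "A = insert Eps (Lett ` {..<k}) \<union> (Star ` A \<union> (case_prod Plus ` (P \<times> P) \<union> case_prod Times ` (A \<times> A)))"
  shows "gf A = fps_const (of_nat (k + 1)) * fps_X + fps_X * gf A + fps_X * (gf P)\<^sup>2 + fps_X * (gf A)\<^sup>2"
proof -
  have "gf A = gf (insert Eps (Lett ` {..<k})) + (gf (Star ` A) +
     (gf (case_prod Plus ` (P \<times> P)) + gf (case_prod Times ` (A \<times> A))))"
  proof -
    let ?T = "case_prod Times ` (A \<times> A)" and ?P = "case_prod Plus ` (P \<times> P)"
    have sub: "?T \<subseteq> Collect (over k)" "?P \<subseteq> Collect (over k)" "Star ` A \<subseteq> Collect (over k)"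
        "insert Eps (Lett ` {..<k}) \<subseteq> Collect (over k)"
      using assms(1,2) by auto
    have "gf (?P \<union> ?T) = gf ?P + gf ?T"
      by (rule gf_Un[of _ k]) (use sub in auto)
    moreover have "gf (Star ` A \<union> (?P \<union> ?T)) = gf (Star ` A) + gf (?P \<union> ?T)"
      by (rule gf_Un[of _ k]) (use sub in auto)
    moreover have "gf (insert Eps (Lett ` {..<k}) \<union> (Star ` A \<union> (?P \<union> ?T)))
        = gf (insert Eps (Lett ` {..<k})) + gf (Star ` A \<union> (?P \<union> ?T))"
      by (rule gf_Un[of _ k]) (use sub in auto)
    ultimately show ?thesis
      by (subst A) (simp only:)
  qed
  also have "gf (Star ` A) = fps_X * gf A"
    by (rule gf_unary) (auto simp: inj_def)
  also have "gf (case_prod Plus ` (P \<times> P)) = fps_X * (gf P * gf P)"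
    by (rule gf_binary[OF assms(2,2)]) (auto simp: inj_def)
  also have "gf (case_prod Times ` (A \<times> A)) = fps_X * (gf A * gf A)"
    by (rule gf_binary[OF assms(1,1)]) (auto simp: inj_def)
  finally show ?thesis
    by (simp add: gf_atoms power2_eq_square add_ac)
qed

lemma gf_over:
  fixes k :: nat
  defines "B \<equiv> gf (Collect (over k))"
  shows "B = fps_const (of_nat (k + 1)) * fps_X + fps_X * B + 2 * fps_X * B\<^sup>2"
proof -
  let ?O = "Collect (over k)"
  have "r \<in> ?O \<longleftrightarrow> r \<in> insert Eps (Lett ` {..<k}) \<union> (Star ` ?O \<union> (case_prod Plus ` (?O \<times> ?O) \<union> case_prod Times ` (?O \<times> ?O)))" for r
    by (cases r) auto
  then have "?O = insert Eps (Lett ` {..<k}) \<union> (Star ` ?O \<union> (case_prod Plus ` (?O \<times> ?O) \<union> case_prod Times ` (?O \<times> ?O)))"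
    by blast
  from gf_grammar[OF order_refl order_refl this] show ?thesis
    unfolding B_def by (simp only: mult_2 distrib_right add.assoc)
qed

section \<open>Counting Sigma-star expressions: bracketings of a fixed word, then orders of the
  letters\<close>

definition plane_trees :: "nat list \<Rightarrow> rexp set" where
  "plane_trees xs = {t. union_tree t \<and> leaves t = xs}"

lemma leaves_nonempty: "union_tree t \<Longrightarrow> leaves t \<noteq> []"
  by (induction t) auto

text \<open>The index \<open>i\<close> is the number of leaves of the left operand. The values 0 and
  \<open>length xs\<close> give empty products, but keeping them yields the shape of a Cauchy
  product.\<close>

lemma plane_trees_rec:
  assumes "length xs \<ge> 2"
  shows "plane_trees xs = (\<Union>i\<in>{0..length xs}. case_prod Plus ` (plane_trees (take i xs) \<times> plane_trees (drop i xs)))"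
    (is "?L = ?R")
proof (intro equalityI subsetI)
  fix t assume t: "t \<in> ?L"
  with assms obtain u v where uv: "t = Plus u v" by (cases t) (auto simp: plane_trees_def)
  with t have "u \<in> plane_trees (take (length (leaves u)) xs)" "v \<in> plane_trees (drop (length (leaves u)) xs)"
      "length (leaves u) \<le> length xs"
    by (auto simp: plane_trees_def)
  with uv show "t \<in> ?R" by auto
next
  fix t assume "t \<in> ?R"
  then obtain i u v where "t = Plus u v" "u \<in> plane_trees (take i xs)" "v \<in> plane_trees (drop i xs)"
    by auto
  then show "t \<in> ?L" by (auto simp: plane_trees_def)
qed

text \<open>The Catalan number with index \<open>n - 1\<close>, which counts the binary trees with
  \<open>n\<close> leaves; 0 for \<open>n = 0\<close>, where there is no tree.\<close>

definition catalan_shift :: "nat \<Rightarrow> real" where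
  "catalan_shift n = (if n = 0 then 0 else fact (2 * n - 2) / (fact n * fact (n - 1)))"

text \<open>Both sides grow by the factor \<open>(4 * n - 2) / (n + 1)\<close>. Thus sqrt(1 - 4z) =
  1 - 2c(z), with c the generating function of \<open>catalan_shift\<close>.\<close>

lemma catalan_shift_gbinomial:
  "n > 0 \<Longrightarrow> (-4) ^ n * ((1/2) gchoose n) = - 2 * catalan_shift n"
proof (induction n rule: nat_induct_non_zero)
  case 1
  then show ?case by (simp add: catalan_shift_def)
next
  case (Suc n)
  then obtain m where m: "n = Suc m" by (cases n) auto
  have "(-4) ^ Suc n * ((1/2::real) gchoose Suc n) = (4 * real n - 2) / real (Suc n) * ((-4) ^ n * ((1/2) gchoose n))"
    by (simp add: gbinomial_half_Suc field_simps)
  also have "\<dots> = (4 * real n - 2) / real (Suc n) * (- 2 * catalan_shift n)"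
    using Suc by simp
  also have "\<dots> = - 2 * catalan_shift (Suc n)"
    by (simp add: catalan_shift_def m divide_simps) (simp add: algebra_simps)
  finally show ?case .
qed

text \<open>Squaring 1 - 2c gives 1 - 4X, which has no term of degree 2 or more, so c and its square
  agree there.\<close>

lemma catalan_shift_rec:
  assumes "n \<ge> 2"
  shows "catalan_shift n = (\<Sum>i=0..n. catalan_shift i * catalan_shift (n - i))"
proof -
  define A where "A = fps_binomial (1/2 :: real) oo (fps_const (-4) * fps_X)"
  have "A = 1 - 2 * Abs_fps catalan_shift"
  proof (rule fps_ext)
    fix n show "A $ n = (1 - 2 * Abs_fps catalan_shift) $ n"
    proof (cases "n = 0")
      case True then show ?thesis by (simp add: A_def catalan_shift_def)
    next
      case False
      then have "A $ n = - 2 * catalan_shift n"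
        unfolding A_def fps_nth_compose_linear by (simp add: catalan_shift_gbinomial)
      then show ?thesis using False by simp
    qed
  qed
  then have "(1 - 2 * Abs_fps catalan_shift)\<^sup>2 = 1 + fps_const (-4) * fps_X"
    using fps_binomial_half_scaled_power2[of "-4::real"] by (simp add: A_def)
  then have "((1 - 2 * Abs_fps catalan_shift)\<^sup>2) $ n = (1 + fps_const (-4) * fps_X) $ n"
    by (rule arg_cong)
  moreover have "(1 - 2 * Abs_fps catalan_shift)\<^sup>2
      = 1 - fps_const 4 * Abs_fps catalan_shift + fps_const 4 * (Abs_fps catalan_shift * Abs_fps catalan_shift)"
    by (simp add: power2_eq_square algebra_simps numeral_fps_const)
  moreover have "(Abs_fps catalan_shift * Abs_fps catalan_shift) $ n
      = (\<Sum>i=0..n. catalan_shift i * catalan_shift (n - i))"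
    by (simp add: fps_mult_nth)
  moreover have "(1 + fps_const (-4) * fps_X :: real fps) $ n = 0"
    using assms by (simp only: fps_add_nth fps_mult_left_const_nth fps_X_nth fps_one_nth) auto
  ultimately show ?thesis
    using assms by (simp only: fps_add_nth fps_sub_nth fps_mult_left_const_nth fps_one_nth fps_nth_Abs_fps) auto
qed

lemma card_plane_trees: "finite (plane_trees xs) \<and> real (card (plane_trees xs)) = catalan_shift (length xs)"
proof (induction xs rule: length_induct)
  case (1 xs)
  consider "xs = []" | a where "xs = [a]" | "length xs \<ge> 2"
    by (cases xs rule: remdups_adj.cases) auto
  then show ?case
  proof cases
    case 1
    then have "plane_trees xs = {}" using leaves_nonempty by (auto simp: plane_trees_def)
    with 1 show ?thesis by (simp add: catalan_shift_def)
  next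
    case 2
    have "t = Lett a" if "union_tree t" "leaves t = [a]" for t
      using that leaves_nonempty by (cases t) (auto simp: append_eq_Cons_conv)
    then have "plane_trees xs = {Lett a}" using 2 by (auto simp: plane_trees_def)
    with 2 show ?thesis by (simp add: catalan_shift_def)
  next
    case 3
    define P where "P = (\<lambda>i. plane_trees (take i xs) \<times> plane_trees (drop i xs))"
    have IH: "finite (P i) \<and> real (card (P i)) = catalan_shift i * catalan_shift (length xs - i)" if i: "i \<le> length xs" for i
    \<comment> \<open>At the two ends one part is \<open>xs\<close> itself, out of reach of the
      induction hypothesis; the other part is empty and makes the product vanish on both
      sides.\<close>
    proof (cases "i = 0 \<or> i = length xs")
      case True
      moreover have "plane_trees [] = {}" using leaves_nonempty by (auto simp: plane_trees_def)
      ultimately have "P i = {}" by (auto simp: P_def)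
      with True show ?thesis by (auto simp: catalan_shift_def)
    next
      case False
      then have "length (take i xs) < length xs" "length (drop i xs) < length xs" using i by auto
      then show ?thesis using 1 i by (simp add: P_def card_cartesian_product min_def)
    qed
    have eq: "plane_trees xs = case_prod Plus ` (\<Union>i\<in>{0..length xs}. P i)"
      unfolding P_def by (subst plane_trees_rec[OF 3]) auto
    have "card (plane_trees xs) = card (\<Union>i\<in>{0..length xs}. P i)"
      unfolding eq by (rule card_image) (auto simp: inj_on_def)
    also have "\<dots> = (\<Sum>i=0..length xs. card (P i))"
    proof (rule card_UN_disjoint)
      show "\<forall>i\<in>{0..length xs}. finite (P i)" using IH by simp
      \<comment> \<open>The index can be read off the left operand, hence disjointness.\<close>
      have "i = length (leaves (fst p))" if "p \<in> P i" "i \<le> length xs" for p i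
        using that by (auto simp: P_def plane_trees_def)
      then show "\<forall>i\<in>{0..length xs}. \<forall>j\<in>{0..length xs}. i \<noteq> j \<longrightarrow> P i \<inter> P j = {}"
        by (metis atLeastAtMost_iff disjoint_iff)
    qed simp
    finally have "real (card (plane_trees xs)) = (\<Sum>i=0..length xs. real (card (P i)))" by simp
    also have "\<dots> = catalan_shift (length xs)"
      using IH by (simp add: catalan_shift_rec[OF 3])
    finally show ?thesis using IH eq by auto
  qed
qed

text \<open>As the letters are distinct, the multiset condition says that the leaves form a
  permutation. This separates the order of the letters from the bracketing.\<close>

lemma sigma_star_iff:
  "sigma_star k r \<longleftrightarrow> r \<in> Star ` (\<Union>xs\<in>permutations_of_set {..<k}. plane_trees xs)"
proof -
  have "mset xs = mset [0..<k] \<longleftrightarrow> xs \<in> permutations_of_set {..<k}" for xs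
  proof
    assume *: "mset xs = mset [0..<k]"
    from mset_eq_setD[OF *] mset_eq_imp_distinct_iff[OF *] show "xs \<in> permutations_of_set {..<k}"
      by (simp add: permutations_of_set_def atLeast0LessThan)
  next
    assume "xs \<in> permutations_of_set {..<k}"
    then show "mset xs = mset [0..<k]"
      using set_eq_iff_mset_eq_distinct[of xs "[0..<k]"]
      by (simp add: permutations_of_set_def atLeast0LessThan)
  qed
  then show ?thesis
    by (cases r) (auto simp: plane_trees_def)
qed

lemma union_tree_rsize: "union_tree t \<Longrightarrow> Suc (rsize t) = 2 * length (leaves t)"
  by (induction t) auto

lemma union_tree_over: "union_tree t \<Longrightarrow> set (leaves t) \<subseteq> {..<k} \<Longrightarrow> over k t"
  by (induction t) auto

lemma union_tree_na: "union_tree t \<Longrightarrow> na k t"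
proof (induction t)
  case (Plus u v)
  then show ?case by (cases u; cases v) auto
qed auto

lemma sigma_starD:
  assumes "sigma_star k r"
  shows "over k r" "na k r" "rsize r = 2 * k"
proof -
  from assms obtain t where t: "r = Star t" "union_tree t" "mset (leaves t) = mset [0..<k]"
    by (cases r) auto
  from mset_eq_setD[OF t(3)] mset_eq_length[OF t(3)] t(1,2) union_tree_over[of t k]
    union_tree_na[of t k] union_tree_rsize[of t]
  show "over k r" "na k r" "rsize r = 2 * k" by (auto simp: atLeast0LessThan)
qed

text \<open>There are \<open>k!\<close> orders and, for each, a Catalan number of bracketings; the
  factor \<open>k!\<close> cancels in the product.\<close>

lemma card_sigma_star:
  assumes "k > 0"
  shows "real (card (Collect (sigma_star k))) = Ck k"
proof -
  have "Collect (sigma_star k) = Star ` (\<Union>xs\<in>permutations_of_set {..<k}. plane_trees xs)"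
    using sigma_star_iff by auto
  then have "card (Collect (sigma_star k)) = card (\<Union>xs\<in>permutations_of_set {..<k}. plane_trees xs)"
    by (simp add: card_image inj_on_def)
  also have "\<dots> = (\<Sum>xs\<in>permutations_of_set {..<k}. card (plane_trees xs))"
    by (rule card_UN_disjoint) (use card_plane_trees in \<open>auto simp: plane_trees_def\<close>)
  finally have "real (card (Collect (sigma_star k))) = (\<Sum>xs\<in>permutations_of_set {..<k}. catalan_shift (length xs))"
    using card_plane_trees by simp
  also have "\<dots> = (\<Sum>xs\<in>permutations_of_set {..<k}. catalan_shift k)"
    by (rule sum.cong) (auto simp: permutations_of_set_def distinct_card[symmetric])
  also have "\<dots> = Ck k"
    using assms by (simp add: catalan_shift_def Ck_def)
  finally show ?thesis .
qed

lemma gf_sigma_star: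
  assumes "k > 0"
  shows "gf (Collect (sigma_star k)) = fps_const (of_real (Ck k)) * fps_X ^ (2 * k)"
proof (rule fps_ext)
  fix n
  have "{r \<in> Collect (sigma_star k). rsize r = n} = (if n = 2 * k then Collect (sigma_star k) else {})"
    using sigma_starD(3) by auto
  moreover have "(of_nat (card (Collect (sigma_star k))) :: complex) = of_real (Ck k)"
    unfolding card_sigma_star[OF assms, symmetric] by simp
  ultimately show "gf (Collect (sigma_star k)) $ n = (fps_const (of_real (Ck k)) * fps_X ^ (2 * k)) $ n"
    by (simp add: gf_def fps_X_power_nth)
qed

text \<open>The operands of a union are the members of the class that are not Sigma-star
  expressions. Every Sigma-star expression belongs to the class, so their generating function is
  exactly \<open>R - S\<close>.\<close>

lemma gf_na:
  fixes k :: nat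
  assumes "k > 0"
  defines "R \<equiv> gf {r. over k r \<and> na k r}"
    and "S \<equiv> fps_const (of_real (Ck k)) * fps_X ^ (2 * k)"
  shows "R = fps_const (of_nat (k + 1)) * fps_X + fps_X * R + fps_X * (R - S)\<^sup>2 + fps_X * R\<^sup>2"
proof -
  let ?R = "{r. over k r \<and> na k r}"
  let ?Q = "{r. over k r \<and> na k r \<and> \<not> sigma_star k r}"
  have "r \<in> ?R \<longleftrightarrow> r \<in> insert Eps (Lett ` {..<k}) \<union> (Star ` ?R \<union> (case_prod Plus ` (?Q \<times> ?Q) \<union> case_prod Times ` (?R \<times> ?R)))" for r
    by (cases r) auto
  then have eq: "?R = insert Eps (Lett ` {..<k}) \<union> (Star ` ?R \<union> (case_prod Plus ` (?Q \<times> ?Q) \<union> case_prod Times ` (?R \<times> ?R)))"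
    by blast
  have "?R = ?Q \<union> Collect (sigma_star k)"
    using sigma_starD by auto
  then have "gf ?R = gf ?Q + gf (Collect (sigma_star k))"
    by (simp only:) (rule gf_Un[of _ k], use sigma_starD in auto)
  then have "gf ?Q = R - S"
    using gf_sigma_star[OF assms(1)] by (simp add: R_def S_def)
  moreover have "?R \<subseteq> Collect (over k)" "?Q \<subseteq> Collect (over k)" by auto
  ultimately show ?thesis
    using gf_grammar[OF _ _ eq] unfolding R_def by simp
qed

section \<open>The dominant singularity\<close>

text \<open>With \<open>m = k - 1\<close>, \<open>Ck k\<close> is a product of \<open>m\<close>
  factors of size at most \<open>2 * m\<close>. Pairing each with one factor
  \<open>1 / (8 + 8k)\<close> gives at most \<open>1/4\<close>, and one such factor
  \<open>1 / (8 + 8k)\<close> is left over.\<close>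

lemma Ck_power_bound:
  assumes k: "k \<ge> 2"
  shows "Ck k * (1 / sqrt (8 + 8 * real k)) ^ (2 * k) \<le> 1 / (32 * (real k + 1))"
proof -
  define m where "m = k - 1"
  have km: "k = Suc m" "m \<ge> 1" using k by (auto simp: m_def)
  have "(fact m :: nat) dvd fact (2 * m)" by (rule fact_dvd) simp
  then have "Ck k = real (fact (2 * m) div fact m)"
    by (simp add: Ck_def km real_of_nat_div)
  also have "(fact (2 * m) div fact m :: nat) \<le> (2 * m) ^ m"
    using fact_div_fact_le_pow[of m "2 * m"] by simp
  finally have C: "Ck k \<le> (2 * real m) ^ m" by simp
  have "Ck k * (1 / sqrt (8 + 8 * real k)) ^ (2 * k) = Ck k * (1 / (8 + 8 * real k)) ^ k"
    by (simp add: power_mult power_divide)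
  also have "\<dots> \<le> (2 * real m) ^ m * (1 / (8 + 8 * real k)) ^ k"
    using C by (intro mult_right_mono) auto
  also have "\<dots> = (2 * real m / (8 + 8 * real k)) ^ m * (1 / (8 + 8 * real k))"
    by (simp add: km power_divide power_mult_distrib)
  also have "\<dots> \<le> (1/4) ^ m * (1 / (8 + 8 * real k))"
    by (intro mult_right_mono power_mono) (auto simp: km field_simps)
  also have "\<dots> \<le> (1/4) ^ 1 * (1 / (8 + 8 * real k))"
    using km(2) by (intro mult_right_mono power_decreasing) auto
  finally show ?thesis by (simp add: field_simps)
qed

lemma Ck_pos: "Ck k > 0"
  by (simp add: Ck_def)

section \<open>Splitting off a root of Delta\<close>

text \<open>The divided difference of the \<open>m\<close>-th power, written as a polynomial so that
  it also makes sense at \<open>z = y\<close>, where it is the derivative.\<close>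

definition power_quot :: "nat \<Rightarrow> 'a \<Rightarrow> 'a \<Rightarrow> 'a :: real_normed_field" where
  "power_quot m y z = (\<Sum>i<m. y ^ (m - Suc i) * z ^ i)"

lemma power_quot_eq: "z ^ m - y ^ m = (z - y) * power_quot m y z"
  unfolding power_quot_def by (rule power_diff_sumr2)

lemma power_quot_diag: "power_quot (Suc m) y y = of_nat (Suc m) * y ^ m"
proof -
  have "power_quot (Suc m) y y = (\<Sum>i<Suc m. y ^ m)"
    unfolding power_quot_def by (intro sum.cong) (auto simp flip: power_add)
  then show ?thesis by simp
qed

lemma norm_power_quot_le:
  assumes "norm y \<le> x" "norm z \<le> x"
  shows "norm (power_quot (Suc m) y z) \<le> of_nat (Suc m) * x ^ m"
proof -
  have x: "0 \<le> x" using assms norm_ge_zero order_trans by blast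
  have "norm (y ^ (m - i) * z ^ i) \<le> x ^ m" if "i \<le> m" for i
  proof -
    have "norm (y ^ (m - i) * z ^ i) \<le> x ^ (m - i) * x ^ i"
      unfolding norm_mult norm_power using assms x by (intro mult_mono power_mono) auto
    also have "\<dots> = x ^ m" using that by (simp flip: power_add)
    finally show ?thesis .
  qed
  then have "norm (power_quot (Suc m) y z) \<le> of_nat (card {..<Suc m}) * x ^ m"
    unfolding power_quot_def by (intro sum_norm_bound) auto
  then show ?thesis by simp
qed

text \<open>Expanded into monomials, so that a linear factor can be divided out term by
  term.\<close>

definition Delta_complex :: "nat \<Rightarrow> complex \<Rightarrow> complex" where
  "Delta_complex k z = 1 - 2 * z - (7 + 8 * of_nat k) * z\<^sup>2
     + 4 * of_real (Ck k) * (z ^ (2*k+1) - z ^ (2*k+2) - of_real (Ck k) * z ^ (4*k+2))"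

lemma Deltak_eq:
  "Deltak k x = 1 - 2 * x - (7 + 8 * real k) * x\<^sup>2
     + 4 * Ck k * (x ^ (2*k+1) - x ^ (2*k+2) - Ck k * x ^ (4*k+2))"
proof -
  have "x ^ (4*k+2) = x ^ (2*k+1) * x ^ (2*k+1)" by (simp flip: power_add)
  moreover have "x ^ (2*k+2) = x ^ (2*k+1) * x" by simp
  ultimately show ?thesis
    unfolding Deltak_def pk_def hk_def by (simp only:) (simp add: algebra_simps)
qed

lemma Delta_complex_of_real: "Delta_complex k (of_real x) = of_real (Deltak k x)"
  by (simp add: Delta_complex_def Deltak_eq)

text \<open>The quotient of Delta by \<open>1 - z / y\<close> when \<open>y\<close> is a root. The
  leading \<open>y\<close> and the reversed signs come from
  \<open>1 - z / y = - (z - y) / y\<close>.\<close>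

definition Delta_cofactor :: "nat \<Rightarrow> complex \<Rightarrow> complex \<Rightarrow> complex" where
  "Delta_cofactor k y z = y * (2 + (7 + 8 * of_nat k) * (z + y)
     - 4 * of_real (Ck k) * (power_quot (2*k+1) y z - power_quot (2*k+2) y z
         - of_real (Ck k) * power_quot (4*k+2) y z))"

lemma Delta_complex_factor:
  assumes "Delta_complex k y = 0" "y \<noteq> 0"
  shows "(1 - z / y) * Delta_cofactor k y z = Delta_complex k z"
proof -
  have "Delta_complex k z = Delta_complex k z - Delta_complex k y"
    using assms by simp
  also have "\<dots> = - 2 * (z - y) - (7 + 8 * of_nat k) * (z\<^sup>2 - y\<^sup>2)
     + 4 * of_real (Ck k) * ((z ^ (2*k+1) - y ^ (2*k+1)) - (z ^ (2*k+2) - y ^ (2*k+2))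
        - of_real (Ck k) * (z ^ (4*k+2) - y ^ (4*k+2)))"
    by (simp add: Delta_complex_def algebra_simps)
  also have "\<dots> = (1 - z / y) * Delta_cofactor k y z"
    unfolding power_quot_eq[of z "2*k+1"] power_quot_eq[of z "2*k+2"] power_quot_eq[of z "4*k+2"]
      Delta_cofactor_def using assms(2)
    by (simp add: field_simps power2_eq_square)
  finally show ?thesis by simp
qed

text \<open>The sum in the first claim bounds the Lipschitz constant of Delta - p on the disc of
  radius \<open>x\<close>. Everything is expressed through \<open>t = Ck k * x ^ (2*k)\<close>, for
  which \<open>32 * (k + 1) * t \<le> 1\<close>.\<close>

lemma perturbation_small:
  assumes k: "k \<ge> 2"
  defines "x \<equiv> 1 / sqrt (8 + 8 * real k)"
  shows "4 * Ck k * (real (2*k+1) * x ^ (2*k) + real (2*k+2) * x ^ (2*k+1)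
      + Ck k * (real (4*k+2) * x ^ (4*k+1))) < 1"
    and "x \<le> 1/4" and "0 < x" and "Ck k * x ^ (2*k) \<le> 1/96"
proof -
  define t where "t = Ck k * x ^ (2*k)"
  show x0: "0 < x" by (simp add: x_def)
  have "4 \<le> sqrt (8 + 8 * real k)" using k by (intro real_le_rsqrt) simp
  then show x4: "x \<le> 1/4" by (simp add: x_def field_simps)
  have t0: "0 \<le> t" using x0 Ck_pos[of k] by (simp add: t_def)
  have t: "32 * ((real k + 1) * t) \<le> 1"
    using Ck_power_bound[OF k] by (simp add: t_def x_def field_simps)
  have "3 * t \<le> (real k + 1) * t" using k t0 by (intro mult_right_mono) auto
  with t show t96: "Ck k * x ^ (2*k) \<le> 1/96" by (simp add: t_def)
  have "4 * Ck k * (real (2*k+1) * x ^ (2*k) + real (2*k+2) * x ^ (2*k+1)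
      + Ck k * (real (4*k+2) * x ^ (4*k+1)))
      = 4 * real (2*k+1) * t + 4 * real (2*k+2) * t * x + 4 * real (4*k+2) * t * (t * x)"
  proof -
    have "x ^ (4*k+1) = x ^ (2*k) * x ^ (2*k) * x" by (simp flip: power_add)
    moreover have "x ^ (2*k+1) = x ^ (2*k) * x" by simp
    ultimately show ?thesis unfolding t_def by (simp only:) (simp add: algebra_simps)
  qed
  \<comment> \<open>The leading factors of the three terms are at most \<open>8(k+1)t\<close>,
    \<open>8(k+1)t\<close> and \<open>16(k+1)t\<close>; the remaining ones use
    \<open>x \<le> 1/4\<close> and \<open>t \<le> 1/96\<close>.\<close>
  also have "\<dots> \<le> 1/4 + 1/4 * (1/4) + 1/2 * (1/96 * (1/4))"
  proof (intro add_mono mult_mono)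
    show "4 * real (2*k+1) * t \<le> 1/4" "4 * real (2*k+2) * t \<le> 1/4" "4 * real (4*k+2) * t \<le> 1/2"
      using t t0 by (auto simp: algebra_simps)
  qed (use x0 x4 t0 t96 in \<open>auto simp: t_def\<close>)
  finally show "4 * Ck k * (real (2*k+1) * x ^ (2*k) + real (2*k+2) * x ^ (2*k+1)
      + Ck k * (real (4*k+2) * x ^ (4*k+1))) < 1" by simp
qed

text \<open>Since \<open>\<rho> \<le> y\<close>, the quadratic part contributes a real part of at least \<open>1\<close>
  even at the leftmost point of the disc, which beats the perturbation.
  So \<open>y\<close> is a simple zero and the only one in the disc.\<close>

lemma Re_Delta_cofactor_pos:
  assumes k: "k \<ge> 2"
    and y: "rhok k \<le> y" "y \<le> 1 / sqrt (8 + 8 * real k)"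
    and z: "norm z \<le> 1 / sqrt (8 + 8 * real k)"
  shows "Re (Delta_cofactor k (of_real y) z) > 0"
proof -
  define s where "s = sqrt (8 + 8 * real k)"
  define x where "x = 1 / s"
  have s0: "s > 0" and s2: "s\<^sup>2 = 8 + 8 * real k" by (auto simp: s_def)
  have s1: "s > 1" using s2 s0 k by (intro power_less_imp_less_base[of 1 2 s]) auto
  note small = perturbation_small[OF k, folded s_def, folded x_def]
  have rho: "rhok k = 1 / (1 + s)" by (simp add: rhok_def s_def)
  have y0: "y > 0" using y(1) s0 unfolding rho by (smt (verit) divide_pos_pos)
  have yx: "norm (complex_of_real y) \<le> x" using y(2) y0 by (simp add: x_def s_def)
  have zx: "norm z \<le> x" using z by (simp add: x_def s_def)
  \<comment> \<open>The divided difference of Delta - p between \<open>y\<close> and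
    \<open>z\<close>.\<close>
  define E where "E = 4 * of_real (Ck k) * (power_quot (2*k+1) (of_real y) z - power_quot (2*k+2) (of_real y) z
         - of_real (Ck k) * power_quot (4*k+2) (of_real y) z)"
  have "norm E \<le> 4 * Ck k * (real (2*k+1) * x ^ (2*k) + real (2*k+2) * x ^ (2*k+1)
      + Ck k * (real (4*k+2) * x ^ (4*k+1)))"
  proof -
    have q: "norm (power_quot (2*k+1) (of_real y) z) \<le> real (2*k+1) * x ^ (2*k)"
      "norm (power_quot (2*k+2) (of_real y) z) \<le> real (2*k+2) * x ^ (2*k+1)"
      "norm (power_quot (4*k+2) (of_real y) z) \<le> real (4*k+2) * x ^ (4*k+1)"
      using norm_power_quot_le[OF yx zx, of "2*k"] norm_power_quot_le[OF yx zx, of "2*k+1"]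
        norm_power_quot_le[OF yx zx, of "4*k+1"] by simp_all
    have "norm (of_real (Ck k) * power_quot (4*k+2) (of_real y) z) \<le> Ck k * (real (4*k+2) * x ^ (4*k+1))"
      using q(3) Ck_pos[of k] by (simp add: norm_mult)
    then have "norm (power_quot (2*k+1) (of_real y) z - power_quot (2*k+2) (of_real y) z
         - of_real (Ck k) * power_quot (4*k+2) (of_real y) z)
       \<le> real (2*k+1) * x ^ (2*k) + real (2*k+2) * x ^ (2*k+1) + Ck k * (real (4*k+2) * x ^ (4*k+1))"
      using q by (intro order_trans[OF norm_triangle_ineq4] add_mono) auto
    then show ?thesis
      unfolding E_def norm_mult using Ck_pos[of k] by (simp add: mult_left_mono)
  qed
  with small(1) have "norm E < 1" by linarith
  then have E: "Re E < 1" using complex_Re_le_cmod[of E] by linarith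
  have "- x \<le> Re z" using zx abs_Re_le_cmod[of z] by linarith
  then have "rhok k - x \<le> Re z + y" using y(1) by linarith
  \<comment> \<open>Here \<open>s^2 - 1 = 7 + 8k\<close> is the coefficient of the quadratic part.
    It turns the worst case \<open>rhok k - x\<close> into \<open>x - 1 > -1\<close>, leaving more
    than 1 to set against \<open>Re E < 1\<close>.\<close>
  moreover have "(s\<^sup>2 - 1) * (rhok k - x) = - 1 + x"
  proof -
    have "s\<^sup>2 - 1 = (s - 1) * (1 + s)" by (simp add: power2_eq_square algebra_simps)
    then have "(s\<^sup>2 - 1) * rhok k = s - 1" using s0 by (simp add: rho)
    moreover have "(s\<^sup>2 - 1) * x = s - x" using s0 by (simp add: x_def power2_eq_square field_simps)
    ultimately show ?thesis by (simp add: right_diff_distrib)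
  qed
  moreover have "(s\<^sup>2 - 1) * (rhok k - x) \<le> (s\<^sup>2 - 1) * (Re z + y)"
    using s1 calculation by (intro mult_left_mono) auto
  ultimately have "1 \<le> 2 + (7 + 8 * real k) * (Re z + y)"
    using s2 small(3) by simp
  with E y0 have "0 < y * (2 + (7 + 8 * real k) * (Re z + y) - Re E)"
    by (intro mult_pos_pos) auto
  also have "\<dots> = Re (Delta_cofactor k (of_real y) z)"
  proof -
    have "Delta_cofactor k (of_real y) z = of_real y * (2 + of_real (7 + 8 * real k) * (z + of_real y) - E)"
      by (simp add: Delta_cofactor_def E_def)
    then show ?thesis by simp
  qed
  finally show ?thesis .
qed

text \<open>Delta is positive at rho, where p vanishes and h is positive, and negative at the right
  end, where p dominates; this gives a root. By the positivity of the cofactor it is the only one in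
  the interval, so the description defining \<open>etak\<close> is proper.\<close>

lemma etak_root:
  assumes k: "k \<ge> 2"
  shows "rhok k < etak k" "etak k < 1 / sqrt (8 + 8 * real k)" "Deltak k (etak k) = 0"
proof -
  define s where "s = sqrt (8 + 8 * real k)"
  define x where "x = 1 / s"
  have s0: "s > 0" and s2: "s\<^sup>2 = 8 + 8 * real k" by (auto simp: s_def)
  note small = perturbation_small[OF k, folded s_def, folded x_def]
  have rho: "rhok k = 1 / (1 + s)" by (simp add: rhok_def s_def)
  have rho0: "rhok k > 0" and rhox: "rhok k < x"
    using s0 by (auto simp: rho x_def field_simps)
  have Cp: "Ck k * r ^ (2*k+1) \<le> 1/96 * x" if "0 \<le> r" "r \<le> x" for r
  proof -
    have "Ck k * r ^ (2*k+1) \<le> Ck k * x ^ (2*k+1)"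
      using that Ck_pos[of k] by (intro mult_left_mono power_mono) auto
    also have "\<dots> \<le> 1/96 * x" using small(3,4) by simp
    finally show ?thesis .
  qed
  have "pk k (rhok k) = 0"
    using s0 s2 unfolding pk_def rho by (simp add: field_simps power2_eq_square)
  moreover have "hk k (rhok k) > 0"
    using Cp[of "rhok k"] rho0 rhox small(2) by (simp add: hk_def)
  ultimately have pos: "Deltak k (rhok k) > 0"
    using rho0 Ck_pos[of k] by (simp add: Deltak_def)
  \<comment> \<open>Because \<open>(s * x)^2 = 1\<close>, the constant term cancels. The
    perturbation is at most \<open>x / 24\<close>, too small to change the sign.\<close>
  have px: "pk k x = x * (x - 2)"
  proof -
    have "(7 + 8 * real k) * x\<^sup>2 = (s * x)\<^sup>2 - x\<^sup>2"
      by (simp only: power_mult_distrib s2) (simp add: algebra_simps)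
    also have "s * x = 1" using s0 by (simp add: x_def)
    finally show ?thesis by (simp add: pk_def power2_eq_square algebra_simps)
  qed
  have "0 \<le> Ck k * x ^ (2*k+1)" using small(3) Ck_pos[of k] by simp
  then have "hk k x \<le> 1" using small(3) unfolding hk_def by linarith
  then have "4 * x ^ (2*k+1) * Ck k * hk k x \<le> 4 * x ^ (2*k+1) * Ck k * 1"
    using small(3) Ck_pos[of k] by (intro mult_left_mono) auto
  also have "\<dots> \<le> x * (1/24)" using Cp[of x] small(3) by (simp add: mult_ac)
  finally have "Deltak k x \<le> x * (x - 2 + 1/24)"
    unfolding Deltak_def px by (simp add: algebra_simps)
  also have "\<dots> < 0" using small(2,3) by (intro mult_pos_neg) auto
  finally have neg: "Deltak k x < 0" .
  have "continuous_on {rhok k..x} (Deltak k)"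
    unfolding Deltak_def pk_def hk_def by (intro continuous_intros)
  then obtain e where e: "rhok k \<le> e" "e \<le> x" "Deltak k e = 0"
    using IVT2'[of "Deltak k" x 0 "rhok k"] pos neg rhox by auto
  have e': "rhok k < e" "e < x"
    using e pos neg by (auto simp: order_le_less)
  have "etak k = e"
    unfolding etak_def
  proof (rule the_equality)
    fix d assume d: "0 < d \<and> d < 1 / sqrt (8 + 8 * real k) \<and> Deltak k d = 0"
    \<comment> \<open>A second root \<open>d\<close> must annihilate the linear factor, since the
      cofactor is nonzero there.\<close>
    have "Re (Delta_cofactor k (of_real e) (of_real d)) > 0"
      using Re_Delta_cofactor_pos[OF k e(1), of "of_real d"] e(2) d by (simp add: x_def s_def)
    moreover have "(1 - of_real d / of_real e) * Delta_cofactor k (of_real e) (of_real d) = 0"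
      using e(3) d e' rho0 by (subst Delta_complex_factor) (auto simp: Delta_complex_of_real)
    ultimately have "(1 - of_real d / of_real e :: complex) = 0" by auto
    then have "complex_of_real d = of_real e" using e' rho0 by (simp add: field_simps)
    then show "d = e" by simp
  qed (use e e' rho0 in \<open>auto simp: x_def s_def\<close>)
  with e e' show "rhok k < etak k" "etak k < 1 / sqrt (8 + 8 * real k)" "Deltak k (etak k) = 0"
    by (auto simp: x_def s_def)
qed

text \<open>On the diagonal the divided differences become derivatives, which is where the factor
  \<open>psik\<close> of the asymptotic constant comes from.\<close>

lemma Delta_cofactor_diag:
  "Delta_cofactor k (of_real y) (of_real y) = of_real (psik k y)"
proof -
  have "(Deltak k has_real_derivative
     - 2 - (7 + 8 * real k) * (2 * y) + 4 * Ck k * (real (2*k+1) * y ^ (2*k) - real (2*k+2) * y ^ (2*k+1)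
        - Ck k * (real (4*k+2) * y ^ (4*k+1)))) (at y)"
    unfolding Deltak_eq[abs_def]
    by (rule derivative_eq_intros refl | simp)+
  then have "psik k y = y * (2 + (7 + 8 * real k) * (2 * y) - 4 * Ck k * (real (2*k+1) * y ^ (2*k)
      - real (2*k+2) * y ^ (2*k+1) - Ck k * (real (4*k+2) * y ^ (4*k+1))))"
    unfolding psik_def by (simp add: DERIV_imp_deriv algebra_simps)
  then show ?thesis
    using power_quot_diag[of "2*k" "complex_of_real y"] power_quot_diag[of "2*k+1" "complex_of_real y"]
      power_quot_diag[of "4*k+1" "complex_of_real y"]
    by (simp add: Delta_cofactor_def)
qed

section \<open>Asymptotics of the coefficients\<close>

lemma R_coeff_asymptotics:
  assumes k: "k \<ge> 2"
  shows "(\<lambda>n. - 4 * real (R_coeff k n) / ((1/2 gchoose Suc n) * (- 1 / etak k) ^ Suc n))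
    \<longlonglongrightarrow> sqrt (psik k (etak k))"
proof -
  define R where "R = gf {r. over k r \<and> na k r}"
  define S :: "complex fps" where "S = fps_const (of_real (Ck k)) * fps_X ^ (2 * k)"
  define F where "F = 1 - fps_X + 2 * fps_X * S - 4 * fps_X * R"
  define r where "r = 1 / sqrt (8 + 8 * real k)"
  note eta = etak_root[OF k]
  have rho0: "rhok k > 0" by (simp add: rhok_def add_pos_nonneg)
  have Req: "R = fps_const (of_nat (k + 1)) * fps_X + fps_X * R + fps_X * (R - S)\<^sup>2 + fps_X * R\<^sup>2"
    unfolding R_def S_def by (rule gf_na) (use k in simp)
  have F2: "F\<^sup>2 = (1 - fps_X + 2 * fps_X * S)\<^sup>2 - 8 * fps_X * (fps_const (of_nat (k + 1)) * fps_X + fps_X * S\<^sup>2)"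
  proof -
    define K :: "complex fps" where "K = fps_const (of_nat (k + 1)) * fps_X"
    \<comment> \<open>Completing the square: the difference is \<open>-8 * fps_X\<close> times the
      defect of the grammar equation.\<close>
    have "F\<^sup>2 - ((1 - fps_X + 2 * fps_X * S)\<^sup>2 - 8 * fps_X * (K + fps_X * S\<^sup>2))
      = - 8 * fps_X * (R - (K + fps_X * R + fps_X * (R - S)\<^sup>2 + fps_X * R\<^sup>2))"
      unfolding F_def by (simp add: algebra_simps power2_eq_square)
    also have "\<dots> = 0" using Req unfolding K_def[symmetric] by simp
    finally show ?thesis unfolding K_def by simp
  qed
  have zfun: "(1 - z / of_real (etak k)) * Delta_cofactor k (of_real (etak k)) z
     = (1 - z + 2 * z * (of_real (Ck k) * z ^ (2 * k)))\<^sup>2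
        - 8 * z * (of_nat (k + 1) * z + z * (of_real (Ck k) * z ^ (2 * k))\<^sup>2)" for z
  proof -
    have "(1 - z / of_real (etak k)) * Delta_cofactor k (of_real (etak k)) z = Delta_complex k z"
      by (rule Delta_complex_factor) (use eta rho0 in \<open>auto simp: Delta_complex_of_real\<close>)
    moreover have "z ^ (4*k+2) = z ^ (2*k) * z ^ (2*k) * z\<^sup>2" "z ^ (2*k+2) = z ^ (2*k) * z\<^sup>2"
        "z ^ (2*k+1) = z ^ (2*k) * z"
      by (simp_all flip: power_add)
    ultimately show ?thesis
      unfolding Delta_complex_def by (simp only:) (simp add: algebra_simps power2_eq_square)
  qed
  have "(\<lambda>n. F $ n / of_real ((1/2 gchoose n) * (- 1 / etak k) ^ n))
      \<longlonglongrightarrow> csqrt (Delta_cofactor k (of_real (etak k)) (of_real (etak k)))"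
  proof (rule sqrt_singularity_transfer[where r = r and a = "etak k" and g = "Delta_cofactor k (of_real (etak k))"])
    show "Delta_cofactor k (of_real (etak k)) holomorphic_on ball 0 r"
      unfolding Delta_cofactor_def power_quot_def by (intro holomorphic_intros)
    show "Re (Delta_cofactor k (of_real (etak k)) z) > 0" if "norm z < r" for z
      by (rule Re_Delta_cofactor_pos[OF k]) (use eta that in \<open>auto simp: r_def\<close>)
    show "(\<lambda>z. (1 - z / of_real (etak k)) * Delta_cofactor k (of_real (etak k)) z) has_fps_expansion F\<^sup>2"
      unfolding zfun F2 unfolding S_def power2_eq_square by (intro fps_expansion_intros)
  qed (use eta rho0 in \<open>auto simp: r_def F_def\<close>)
  then have "(\<lambda>n. F $ n / of_real ((1/2 gchoose n) * (- 1 / etak k) ^ n)) \<longlonglongrightarrow> csqrt (of_real (psik k (etak k)))"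
    by (simp only: Delta_cofactor_diag)
  moreover have "psik k (etak k) \<ge> 0"
    using Re_Delta_cofactor_pos[OF k, of "etak k" "of_real (etak k)"] eta rho0
    unfolding Delta_cofactor_diag by simp
  ultimately have "(\<lambda>n. F $ n / of_real ((1/2 gchoose n) * (- 1 / etak k) ^ n))
      \<longlonglongrightarrow> of_real (sqrt (psik k (etak k)))"
    by (simp add: csqrt_of_real)
  then have "(\<lambda>n. F $ Suc n / of_real ((1/2 gchoose Suc n) * (- 1 / etak k) ^ Suc n))
      \<longlonglongrightarrow> of_real (sqrt (psik k (etak k)))"
    by (rule LIMSEQ_Suc)
  then have "(\<lambda>n. complex_of_real (- 4 * real (R_coeff k n) / ((1/2 gchoose Suc n) * (- 1 / etak k) ^ Suc n)))
      \<longlonglongrightarrow> of_real (sqrt (psik k (etak k)))"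
  proof (rule Lim_transform_eventually)
    \<comment> \<open>The polynomial part of \<open>F\<close> has degree \<open>2 * k + 1\<close>,
      so beyond it \<open>F $ Suc n\<close> is -4 times \<open>R $ n\<close>. The index shift
      produces the exponent \<open>n + 1\<close> of the theorem.\<close>
    have "\<forall>\<^sub>F n in sequentially. n > 2 * k" by (rule eventually_gt_at_top)
    then show "\<forall>\<^sub>F n in sequentially. F $ Suc n / of_real ((1/2 gchoose Suc n) * (- 1 / etak k) ^ Suc n)
        = of_real (- 4 * real (R_coeff k n) / ((1/2 gchoose Suc n) * (- 1 / etak k) ^ Suc n))"
    proof eventually_elim
      case (elim n)
      have "F = 1 - fps_X + fps_const (2 * of_real (Ck k)) * fps_X ^ (2 * k + 1) - fps_const 4 * (fps_X * R)"
        by (simp add: F_def S_def numeral_fps_const mult_ac flip: fps_const_mult)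
      then have "F $ Suc n = - 4 * R $ n"
        using elim by (simp add: fps_X_power_nth)
      also have "R $ n = of_nat (R_coeff k n)"
        by (simp add: R_def gf_def R_coeff_def conj_assoc)
      finally show ?case by simp
    qed
  qed
  then show ?thesis
    by (simp only: tendsto_of_real_iff)
qed

text \<open>With \<open>s^2 = 8 + 8k\<close>, p factors explicitly as (1 - (1 + s)z)(1 + (s - 1)z).
  The first factor is \<open>1 - z / rhok k\<close>, and the second takes the value
  \<open>2 - 2 * rhok k\<close> at rho.\<close>

lemma B_coeff_asymptotics:
  assumes k: "k \<ge> 1"
  shows "(\<lambda>n. - 4 * real (B_coeff k n) / ((1/2 gchoose Suc n) * (- 1 / rhok k) ^ Suc n))
    \<longlonglongrightarrow> sqrt (2 - 2 * rhok k)"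
proof -
  define B where "B = gf (Collect (over k))"
  define F where "F = 1 - fps_X - 4 * fps_X * B"
  define s where "s = sqrt (8 + 8 * real k)"
  have s0: "s > 0" and s2: "s\<^sup>2 = 8 + 8 * real k" by (auto simp: s_def)
  have s1: "s > 1" using s2 s0 k by (intro power_less_imp_less_base[of 1 2 s]) auto
  have rho: "rhok k = 1 / (1 + s)" by (simp add: rhok_def s_def)
  have rho0: "rhok k > 0" "rhok k < 1 / s" using s0 by (auto simp: rho field_simps)
  define g where "g = (\<lambda>z :: complex. 1 + of_real (s - 1) * z)"
  have Beq: "B = fps_const (of_nat (k + 1)) * fps_X + fps_X * B + 2 * fps_X * B\<^sup>2"
    unfolding B_def by (rule gf_over)
  have F2: "F\<^sup>2 = (1 - fps_X)\<^sup>2 - 8 * fps_X * (fps_const (of_nat (k + 1)) * fps_X)"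
  proof -
    define K :: "complex fps" where "K = fps_const (of_nat (k + 1)) * fps_X"
    have "F\<^sup>2 - ((1 - fps_X)\<^sup>2 - 8 * fps_X * K) = - 8 * fps_X * (B - (K + fps_X * B + 2 * fps_X * B\<^sup>2))"
      unfolding F_def by (simp add: algebra_simps power2_eq_square)
    also have "\<dots> = 0" using Beq unfolding K_def[symmetric] by simp
    finally show ?thesis unfolding K_def by simp
  qed
  have zfun: "(1 - z / of_real (rhok k)) * g z = (1 - z)\<^sup>2 - 8 * z * (of_nat (k + 1) * z)" for z
  proof -
    have "complex_of_real s * of_real s = 8 + 8 * of_nat k"
      using arg_cong[OF s2, of complex_of_real] by (simp add: power2_eq_square)
    moreover have "(1 - z / of_real (rhok k)) * g z
       = (1 - z)\<^sup>2 - complex_of_real s * of_real s * z\<^sup>2"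
      unfolding g_def rho using s0 by (simp add: algebra_simps power2_eq_square)
    ultimately show ?thesis by (simp add: algebra_simps power2_eq_square)
  qed
  have "(\<lambda>n. F $ n / of_real ((1/2 gchoose n) * (- 1 / rhok k) ^ n)) \<longlonglongrightarrow> csqrt (g (of_real (rhok k)))"
  proof (rule sqrt_singularity_transfer[where r = "1 / s"])
    show "g holomorphic_on ball 0 (1 / s)"
      unfolding g_def by (intro holomorphic_intros)
    show "Re (g z) > 0" if "norm z < 1 / s" for z
    proof -
      have "- (1 / s) \<le> Re z" using that abs_Re_le_cmod[of z] by linarith
      then have "(s - 1) * - (1 / s) \<le> (s - 1) * Re z" using s1 by (intro mult_left_mono) auto
      moreover have "(s - 1) * - (1 / s) = - 1 + 1 / s" using s0 by (simp add: field_simps)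
      moreover have "1 / s > 0" using s0 by simp
      ultimately have "0 < 1 + (s - 1) * Re z" by linarith
      then show ?thesis by (simp add: g_def)
    qed
    show "(\<lambda>z. (1 - z / of_real (rhok k)) * g z) has_fps_expansion F\<^sup>2"
      unfolding zfun F2 unfolding power2_eq_square by (intro fps_expansion_intros)
  qed (use rho0 in \<open>auto simp: F_def\<close>)
  moreover have "g (of_real (rhok k)) = of_real (2 - 2 * rhok k)"
  proof -
    have "1 + (s - 1) * rhok k = 2 - 2 * rhok k" unfolding rho using s0 by (simp add: field_simps)
    from arg_cong[OF this, of complex_of_real] show ?thesis by (simp add: g_def)
  qed
  moreover have "2 - 2 * rhok k \<ge> 0" using s0 by (simp add: rho field_simps)
  ultimately have "(\<lambda>n. F $ n / of_real ((1/2 gchoose n) * (- 1 / rhok k) ^ n))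
      \<longlonglongrightarrow> of_real (sqrt (2 - 2 * rhok k))"
    by (simp only: csqrt_of_real)
  then have "(\<lambda>n. F $ Suc n / of_real ((1/2 gchoose Suc n) * (- 1 / rhok k) ^ Suc n))
      \<longlonglongrightarrow> of_real (sqrt (2 - 2 * rhok k))"
    by (rule LIMSEQ_Suc)
  then have "(\<lambda>n. complex_of_real (- 4 * real (B_coeff k n) / ((1/2 gchoose Suc n) * (- 1 / rhok k) ^ Suc n)))
      \<longlonglongrightarrow> of_real (sqrt (2 - 2 * rhok k))"
  proof (rule Lim_transform_eventually)
    have "\<forall>\<^sub>F n in sequentially. n > 0" by (rule eventually_gt_at_top)
    then show "\<forall>\<^sub>F n in sequentially. F $ Suc n / of_real ((1/2 gchoose Suc n) * (- 1 / rhok k) ^ Suc n)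
        = of_real (- 4 * real (B_coeff k n) / ((1/2 gchoose Suc n) * (- 1 / rhok k) ^ Suc n))"
    proof eventually_elim
      case (elim n)
      have "F = 1 - fps_X - fps_const 4 * (fps_X * B)"
        by (simp add: F_def numeral_fps_const mult_ac)
      then have "F $ Suc n = - 4 * B $ n"
        using elim by simp
      also have "B $ n = of_nat (B_coeff k n)"
        by (simp add: B_def gf_def B_coeff_def)
      finally show ?case by simp
    qed
  qed
  then show ?thesis
    by (simp only: tendsto_of_real_iff)
qed

theorem theorem3:
  fixes k :: nat
  assumes "k \<ge> 2"
  shows "(\<lambda>n. real (R_coeff k n) / real (B_coeff k n)) \<sim>[at_top]
    (\<lambda>n. sqrt (psik k (etak k)) / sqrt (2 - 2 * rhok k) * (rhok k / etak k) ^ (n + 1))"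
proof -
  note eta = etak_root[OF assms]
  have rho0: "rhok k > 0" by (simp add: rhok_def add_pos_nonneg)
  have rho1: "rhok k < 1" by (simp add: rhok_def add_pos_nonneg)
  define L where "L = sqrt (psik k (etak k)) / sqrt (2 - 2 * rhok k)"
  have "psik k (etak k) > 0"
    using Re_Delta_cofactor_pos[OF assms, of "etak k" "of_real (etak k)"] eta rho0
    unfolding Delta_cofactor_diag by simp
  then have L0: "L \<noteq> 0" using rho1 by (simp add: L_def)
  \<comment> \<open>The constant -4, the binomial coefficient and the signs occur in both
    normalizations and cancel; only the ratio of the two exponentials survives.\<close>
  have eq: "(- 4 * real (R_coeff k n) / ((1/2 gchoose Suc n) * (- 1 / etak k) ^ Suc n))
      / (- 4 * real (B_coeff k n) / ((1/2 gchoose Suc n) * (- 1 / rhok k) ^ Suc n))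
      = real (R_coeff k n) / real (B_coeff k n) / (rhok k / etak k) ^ (n + 1)" for n
  proof -
    have *: "(a / (c * (- 1 / e) ^ m)) / (b / (c * (- 1 / d) ^ m)) = a / b / (d / e) ^ m"
      if "c \<noteq> 0" "d > 0" "e > 0" for a b c d e :: real and m
    proof -
      have "(- 1 / d) ^ m / (- 1 / e) ^ m = 1 / (d / e) ^ m"
        using that by (simp flip: power_divide power_one_over)
      moreover have "(a / (c * (- 1 / e) ^ m)) / (b / (c * (- 1 / d) ^ m)) = a / b * ((- 1 / d) ^ m / (- 1 / e) ^ m)"
        using that by simp
      ultimately show ?thesis by simp
    qed
    show ?thesis
      by (subst *) (use eta rho0 gbinomial_half_nonzero in auto)
  qed
  have "(\<lambda>n. real (R_coeff k n) / real (B_coeff k n) / (rhok k / etak k) ^ (n + 1)) \<longlonglongrightarrow> L"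
    unfolding L_def eq[symmetric]
    by (intro tendsto_divide R_coeff_asymptotics B_coeff_asymptotics) (use assms rho1 in auto)
  then have "(\<lambda>n. real (R_coeff k n) / real (B_coeff k n) / (rhok k / etak k) ^ (n + 1) / L) \<longlonglongrightarrow> L / L"
    using L0 by (intro tendsto_divide tendsto_const)
  then have "(\<lambda>n. real (R_coeff k n) / real (B_coeff k n) / (L * (rhok k / etak k) ^ (n + 1))) \<longlonglongrightarrow> 1"
    using L0 by (simp add: mult_ac)
  then show ?thesis
    unfolding L_def[symmetric]
    by (intro asymp_equivI')
qed

end
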